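(* Let $(\Psi,\Psi^* )$ be a pair of Legendre duals, let $S, E \in C^1(Z)$, and let $\mathbf{F}$ be a vector field on $Z$. Let $L=\{L(z)\}_{z\in Z}$ be a family of operators $L(z):T_z^*Z\to T_zZ$ that are anti-symmetric and satisfy the Jacobi identity. Let $W$ be a vector field with $\langle W(z),\mathrm{d}S(z)\rangle=0$ for all $z$, suppose that $W(z) = L(z)\,\mathrm{d}E(z)$, and let $\mathcal{H}_1(z,\xi)=\langle W(z),\xi\rangle$. Let $\mathcal{H}_2 : T^*Z \to \mathbb{R}$ be related to $\Psi^*$ by $$\Psi^*(z,\xi) = \mathcal{H}_2\bigl(z,\xi+\tfrac12 \mathrm{d}S(z)\bigr) - \mathcal{H}_2\bigl(z,\tfrac12 \mathrm{d}S(z)\bigr), \qquad \mathcal{H}_2(z,\xi) = \Psi^*\bigl(z,\xi-\tfrac12 \mathrm{d}S(z)\bigr) - \Psi^*\bigl(z,-\tfrac12 \mathrm{d}S(z)\bigr).$$ Let $\mathcal{H} := \mathcal{H}_1+\mathcal{H}_2$ and let $\mathcal{L}$ be the Legendre dual of $\mathcal{H}$. Then the following are equivalent: (a) $\mathcal{H}_2$ is reversible with respect to $S$, $L\,\mathrm{d}S=0$, and the map $\alpha\mapsto\mathcal{H}_2(z,\xi+\alpha\,\mathrm{d}E(z))$ is constant (for all $(z,\xi)\in T^*Z$); $\mathbf{F}$ is the zero-cost flow for $\mathcal{L}$. (b) $\Psi^*$ is symmetric and $\mathbf{F}$ is GENERIC for $S,E$, dissipation potentials $(\Psi,\Psi^*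 )$ and map $L$. If (a) or (b) is satisfied, then $S$ is a Lyapunov function for $\mathbf{F}$ and the functional $E$ is constant along $\mathbf{F}$.
   Context: $Z$ is a smooth finite-dimensional manifold with tangent bundle $TZ$ and cotangent bundle $T^*Z$; $\langle\cdot,\cdot\rangle$ is the pairing between $T_zZ$ and $T_z^*Z$ (in either order). A vector field is a continuous section $V(z)\in T_zZ$. $C^1(Z)$ is the set of continuously differentiable real functions, with differential $\mathrm{d}F(z)\in T_z^*Z$. Legendre duals: $\Psi: TZ\to[0,\infty]$ and $\Psi^*:T^*Z\to[0,\infty]$ are Legendre duals if $\Psi^*(z,\xi)=\sup_{v\in T_zZ}\{\langle v,\xi\rangle-\Psi(z,v)\}$ and $\Psi(z,v)=\sup_{\xi\in T^*_zZ}\{\langle v,\xi\rangle-\Psi^*(z,\xi)\}$. Likewise the Legendre dual of $\mathcal{H}:T^*Z\to\mathbb{R}$ is $\mathcal{L}(z,v)=\sup_{\xi}\{\langle v,\xi\rangle-\mathcal{H}(z,\xi)\}$. Hamiltonians and their Lagrangians are always assumed to be convex in the second argument and Legendre duals of each other, with $\mathcal{L}\ge 0$ and, for each $z$, $\mathcal{L}(z,v)=0$ for some $v$; equivalently $\mathcal{H}(z,0)=0$ for all $z$. Dissipation potentials: a Legendre pair $(\Psi,\Psi^* )$ such that $\Psi,\Psi^*$ are strictly convex (in the second argument) and continuously differentiable, and $\Psi(z,0)=\Psi^*(z,0)=0$. Symmetric means $\Psi(z,v)=\Psi(z,-v)$, resp. $\Psi^*(z,\xi)=\Psi^*(z,-\xi)$,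 everywhere. Reversible: $\mathcal{H}$ is reversible with respect to $S$ if $\mathcal{H}(z,\xi)=\mathcal{H}(z,\mathrm{d}S(z)-\xi)$ for all $(z,\xi)$. Zero-cost flow: $\mathbf{F}$ is the zero-cost flow for $\mathcal{L}$ if $\mathcal{L}(z,v)=0$ if and only if $v=\mathbf{F}(z)$. Anti-symmetric: $\langle L(z)\xi,\eta\rangle=-\langle L(z)\eta,\xi\rangle$ for all $z$ and $\xi,\eta\in T_z^*Z$. Jacobi identity: the bracket $\{F,G\}:=\langle \mathrm{d}F,L\,\mathrm{d}G\rangle$ satisfies $\{\{F_1,F_2\},F_3\}+\{\{F_3,F_1\},F_2\}+\{\{F_2,F_3\},F_1\}=0$ for all smooth functions $F_1,F_2,F_3$. GENERIC: $\mathbf{F}$ is GENERIC for $S,E$ with dissipation potentials $(\Psi,\Psi^* )$ and map $L$ if (i) $(\Psi,\Psi^* )$ are symmetric dissipation potentials; (ii) $L$ is anti-symmetric and satisfies the Jacobi identity; (iii) $L(z)\,\mathrm{d}S(z)=0$ and $\Psi^*(z,\xi+\alpha\,\mathrm{d}E(z))=\Psi^*(z,\xi)$ for all $z,\xi$ and $\alpha\in\mathbb{R}$; and (iv) for all $z\in Z$ $$\Psi(z,\mathbf{F}(z)-L(z)\,\mathrm{d}E(z))+\Psi^*\bigl(z,-\tfrac12\mathrm{d}S(z)\bigr)+\tfrac12\langle \mathbf{F}(z),\mathrm{d}S(z)\rangle=0.$$ Lyapunov function: $\langle \mathbf{F}(z),\mathrm{d}S(z)\rangle\le 0$ for all $z$.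 "$E$ is constant along $\mathbf{F}$" means $\langle\mathbf{F}(z),\mathrm{d}E(z)\rangle=0$ for all $z$.
   Formalization: That (a) implies (b) is stated for Ψ, Ψ* strictly convex and continuously differentiable, as the definition of dissipation potentials in (b) requires; without this it fails, e.g. for S=E=0, L=0, F=0 and Ψ* smooth, even, superlinear and zero exactly on [-1,1]. *)

theory Defs
  imports "HOL-Analysis.Analysis" "HOL-Library.Function_Algebras"
begin

text \<open>Tangent and cotangent vectors are encoded as functions; their vector space structure is the
  pointwise one (\<^class>\<open>ab_group_add\<close> comes from the theory Function-Algebras).\<close>

instantiation "fun" :: (type, real_vector) real_vector
begin

definition "a *\<^sub>R f = (\<lambda>x. a *\<^sub>R f x)"

instance
  by standard (simp_all add: scaleR_fun_def fun_eq_iff scaleR_add_right scaleR_add_left)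

end

lemma scaleR_fun_apply [simp]: "(a *\<^sub>R f) x = a *\<^sub>R f x"
  by (simp add: scaleR_fun_def)


section \<open>Smooth manifolds\<close>

text \<open>Classes $C^k$ on an \<^emph>\<open>open\<close> set of a finite-dimensional normed space.\<close>

primrec C_k_on :: "nat \<Rightarrow> 'a::real_normed_vector set \<Rightarrow> ('a \<Rightarrow> 'b::real_normed_vector) \<Rightarrow> bool" where
  "C_k_on 0 U f \<longleftrightarrow> continuous_on U f"
| "C_k_on (Suc k) U f \<longleftrightarrow>
     (\<forall>x\<in>U. f differentiable (at x)) \<and> (\<forall>v. C_k_on k U (\<lambda>x. frechet_derivative f (at x) v))"

definition smooth_on :: "'a::real_normed_vector set \<Rightarrow> ('a \<Rightarrow> 'b::real_normed_vector) \<Rightarrow> bool" where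
  "smooth_on U f \<longleftrightarrow> (\<forall>k. C_k_on k U f)"

text \<open>A chart is a pair of its domain and its coordinate map; the values of the map outside of the
  domain are irrelevant.\<close>

type_synonym ('m, 'e) chart = "'m set \<times> ('m \<Rightarrow> 'e)"

abbreviation chart_dom :: "('m, 'e) chart \<Rightarrow> 'm set" where "chart_dom c \<equiv> fst c"
abbreviation chart_map :: "('m, 'e) chart \<Rightarrow> 'm \<Rightarrow> 'e" where "chart_map c \<equiv> snd c"

definition chart_image :: "('m, 'e) chart \<Rightarrow> 'e set" where
  "chart_image c = chart_map c ` chart_dom c"

definition chart_inv :: "('m, 'e) chart \<Rightarrow> 'e \<Rightarrow> 'm" where
  "chart_inv c = inv_into (chart_dom c) (chart_map c)"

abbreviation transition :: "('m, 'e) chart \<Rightarrow> ('m, 'e) chart \<Rightarrow> 'e \<Rightarrow> 'e" where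
  "transition c d \<equiv> chart_map d \<circ> chart_inv c"

definition is_chart :: "('m::topological_space, 'e::real_normed_vector) chart \<Rightarrow> bool" where
  "is_chart c \<longleftrightarrow> open (chart_dom c) \<and> open (chart_image c) \<and>
     homeomorphism (chart_dom c) (chart_image c) (chart_map c) (chart_inv c)"

text \<open>The manifold is the whole type \<open>'m\<close>; its smooth structure is given by an atlas \<open>A\<close> (not
  necessarily maximal) with values in the finite-dimensional space \<open>'e\<close>.\<close>

definition smooth_manifold ::
  "('m::{t2_space, second_countable_topology}, 'e::real_normed_vector) chart set \<Rightarrow> bool" where
  "smooth_manifold A \<longleftrightarrow>
     (\<exists>B::'e set. finite B \<and> span B = UNIV) \<and>
     (\<forall>c\<in>A. is_chart c) \<and> (\<Union>c\<in>A. chart_dom c) = UNIV \<and>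
     (\<forall>c\<in>A. \<forall>d\<in>A. smooth_on (chart_map c ` (chart_dom c \<inter> chart_dom d)) (transition c d))"

definition charts_at :: "('m, 'e) chart set \<Rightarrow> 'm \<Rightarrow> ('m, 'e) chart set" where
  "charts_at A z = {c \<in> A. z \<in> chart_dom c}"

definition C_k :: "('m, 'e::real_normed_vector) chart set \<Rightarrow> nat \<Rightarrow> ('m \<Rightarrow> real) \<Rightarrow> bool" where
  "C_k A k F \<longleftrightarrow> (\<forall>c\<in>A. C_k_on k (chart_image c) (F \<circ> chart_inv c))"

definition smooth_fun :: "('m, 'e::real_normed_vector) chart set \<Rightarrow> ('m \<Rightarrow> real) \<Rightarrow> bool" where
  "smooth_fun A F \<longleftrightarrow> (\<forall>k. C_k A k F)"


section \<open>Tangent and cotangent bundle\<close>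

text \<open>A tangent vector at \<open>z\<close> is the family of its component vectors \<open>v c\<close> in the charts \<open>c\<close> around
  \<open>z\<close>, which transform with the derivatives of the transition maps; the entries for all other \<open>c\<close>
  are set to 0.  The cotangent space is the dual space of the tangent space, a functional being set
  to 0 outside of the tangent space.\<close>

type_synonym ('m, 'e) tvec = "('m, 'e) chart \<Rightarrow> 'e"
type_synonym ('m, 'e) covec = "('m, 'e) tvec \<Rightarrow> real"

definition tangent_space ::
  "('m, 'e::real_normed_vector) chart set \<Rightarrow> 'm \<Rightarrow> ('m, 'e) tvec set" where
  "tangent_space A z = {v.
     (\<forall>c. c \<notin> charts_at A z \<longrightarrow> v c = 0) \<and>
     (\<forall>c\<in>charts_at A z. \<forall>d\<in>charts_at A z.
        v d = frechet_derivative (transition c d) (at (chart_map c z)) (v c))}"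

definition cotangent_space ::
  "('m, 'e::real_normed_vector) chart set \<Rightarrow> 'm \<Rightarrow> ('m, 'e) covec set" where
  "cotangent_space A z = {\<xi>.
     (\<forall>v. v \<notin> tangent_space A z \<longrightarrow> \<xi> v = 0) \<and>
     (\<forall>u\<in>tangent_space A z. \<forall>v\<in>tangent_space A z. \<xi> (u + v) = \<xi> u + \<xi> v) \<and>
     (\<forall>a. \<forall>v\<in>tangent_space A z. \<xi> (a *\<^sub>R v) = a * \<xi> v)}"

abbreviation (input) pairing :: "('m, 'e) tvec \<Rightarrow> ('m, 'e) covec \<Rightarrow> real" where
  "pairing v \<xi> \<equiv> \<xi> v"

text \<open>Meaningful for continuously differentiable \<open>F\<close>; independent of the chosen chart, see
  \<open>differential_in_chart\<close> below.\<close>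

definition differential ::
  "('m, 'e::real_normed_vector) chart set \<Rightarrow> ('m \<Rightarrow> real) \<Rightarrow> 'm \<Rightarrow> ('m, 'e) covec" where
  "differential A F z = (let c = (SOME c. c \<in> charts_at A z) in
     (\<lambda>v. if v \<in> tangent_space A z
          then frechet_derivative (F \<circ> chart_inv c) (at (chart_map c z)) (v c) else 0))"

definition vector_field ::
  "('m::topological_space, 'e::real_normed_vector) chart set \<Rightarrow> ('m \<Rightarrow> ('m, 'e) tvec) \<Rightarrow> bool" where
  "vector_field A V \<longleftrightarrow>
     (\<forall>z. V z \<in> tangent_space A z) \<and> (\<forall>c\<in>A. continuous_on (chart_dom c) (\<lambda>z. V z c))"

text \<open>The (co)tangent vector with given components in the chart \<open>c\<close>, for \<open>c\<close> a chart around \<open>z\<close>.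
  These are the charts of the manifolds $TZ$ and $T^*Z$ that are used to define continuous
  differentiability there.\<close>

definition tvec_of ::
  "('m, 'e::real_normed_vector) chart set \<Rightarrow> ('m, 'e) chart \<Rightarrow> 'm \<Rightarrow> 'e \<Rightarrow> ('m, 'e) tvec" where
  "tvec_of A c z u = (\<lambda>d. if d \<in> charts_at A z
     then frechet_derivative (transition c d) (at (chart_map c z)) u else 0)"

definition covec_of ::
  "('m, 'e::real_normed_vector) chart set \<Rightarrow> ('m, 'e) chart \<Rightarrow> 'm \<Rightarrow> ('e \<Rightarrow>\<^sub>L real) \<Rightarrow> ('m, 'e) covec" where
  "covec_of A c z p = (\<lambda>v. if v \<in> tangent_space A z then blinfun_apply p (v c) else 0)"


section \<open>Legendre duality and dissipation potentials\<close>

type_synonym ('m, 'e) potential = "'m \<Rightarrow> ('m, 'e) tvec \<Rightarrow> ereal"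
type_synonym ('m, 'e) dual_potential = "'m \<Rightarrow> ('m, 'e) covec \<Rightarrow> ereal"

definition legendre_duals ::
  "('m, 'e::real_normed_vector) chart set \<Rightarrow> ('m, 'e) potential \<Rightarrow> ('m, 'e) dual_potential \<Rightarrow> bool" where
  "legendre_duals A \<Psi> \<Psi>s \<longleftrightarrow>
     (\<forall>z. \<forall>v\<in>tangent_space A z. 0 \<le> \<Psi> z v) \<and> (\<forall>z. \<forall>\<xi>\<in>cotangent_space A z. 0 \<le> \<Psi>s z \<xi>) \<and>
     (\<forall>z. \<forall>\<xi>\<in>cotangent_space A z. \<Psi>s z \<xi> = (SUP v\<in>tangent_space A z. ereal (pairing v \<xi>) - \<Psi> z v)) \<and>
     (\<forall>z. \<forall>v\<in>tangent_space A z. \<Psi> z v = (SUP \<xi>\<in>cotangent_space A z. ereal (pairing v \<xi>) - \<Psi>s z \<xi>))"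

definition lagrangian ::
  "('m, 'e::real_normed_vector) chart set \<Rightarrow> ('m \<Rightarrow> ('m, 'e) covec \<Rightarrow> real) \<Rightarrow> ('m, 'e) potential" where
  "lagrangian A H z v = (SUP \<xi>\<in>cotangent_space A z. ereal (pairing v \<xi> - H z \<xi>))"

text \<open>For functions with values in $(-\infty,\infty]$, strict convexity refers to the effective domain.\<close>

definition strictly_convex_on :: "'v::real_vector set \<Rightarrow> ('v \<Rightarrow> ereal) \<Rightarrow> bool" where
  "strictly_convex_on X f \<longleftrightarrow>
     (\<forall>u\<in>X. \<forall>v\<in>X. \<forall>t. u \<noteq> v \<and> f u < \<infinity> \<and> f v < \<infinity> \<and> 0 < t \<and> t < 1 \<longrightarrow>
        f ((1 - t) *\<^sub>R u + t *\<^sub>R v) < ereal (1 - t) * f u + ereal t * f v)"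

definition C1_on_tangent_bundle ::
  "('m, 'e::real_normed_vector) chart set \<Rightarrow> ('m, 'e) potential \<Rightarrow> bool" where
  "C1_on_tangent_bundle A \<Psi> \<longleftrightarrow>
     (\<forall>z. \<forall>v\<in>tangent_space A z. \<bar>\<Psi> z v\<bar> \<noteq> \<infinity>) \<and>
     (\<forall>c\<in>A. C_k_on 1 (chart_image c \<times> UNIV)
        (\<lambda>(x, u). real_of_ereal (\<Psi> (chart_inv c x) (tvec_of A c (chart_inv c x) u))))"

definition C1_on_cotangent_bundle ::
  "('m, 'e::real_normed_vector) chart set \<Rightarrow> ('m, 'e) dual_potential \<Rightarrow> bool" where
  "C1_on_cotangent_bundle A \<Psi>s \<longleftrightarrow>
     (\<forall>z. \<forall>\<xi>\<in>cotangent_space A z. \<bar>\<Psi>s z \<xi>\<bar> \<noteq> \<infinity>) \<and>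
     (\<forall>c\<in>A. C_k_on 1 (chart_image c \<times> UNIV)
        (\<lambda>(x, p). real_of_ereal (\<Psi>s (chart_inv c x) (covec_of A c (chart_inv c x) p))))"

definition regular_pair ::
  "('m, 'e::real_normed_vector) chart set \<Rightarrow> ('m, 'e) potential \<Rightarrow> ('m, 'e) dual_potential \<Rightarrow> bool" where
  "regular_pair A \<Psi> \<Psi>s \<longleftrightarrow>
     (\<forall>z. strictly_convex_on (tangent_space A z) (\<Psi> z)) \<and>
     (\<forall>z. strictly_convex_on (cotangent_space A z) (\<Psi>s z)) \<and>
     C1_on_tangent_bundle A \<Psi> \<and> C1_on_cotangent_bundle A \<Psi>s"

definition dissipation_potentials ::
  "('m, 'e::real_normed_vector) chart set \<Rightarrow> ('m, 'e) potential \<Rightarrow> ('m, 'e) dual_potential \<Rightarrow> bool" where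
  "dissipation_potentials A \<Psi> \<Psi>s \<longleftrightarrow>
     legendre_duals A \<Psi> \<Psi>s \<and> regular_pair A \<Psi> \<Psi>s \<and> (\<forall>z. \<Psi> z 0 = 0 \<and> \<Psi>s z 0 = 0)"

text \<open>If \<open>\<Psi>s z\<close> is invariant in a direction \<open>\<eta> \<noteq> 0\<close>, as the degeneracy condition of GENERIC requires
  for the differential of the energy, then \<open>\<Psi>s z\<close> is not strictly convex and \<open>\<Psi> z\<close> is infinite
  outside of the annihilator of \<open>\<eta>\<close>, hence not differentiable on the tangent bundle (see
  \<open>dissipation_potentials_not_invariant\<close>).  The following weaker notion omits these two requirements
  and is compatible with such an invariance; \<open>\<Psi> z\<close> is strictly convex where it is finite.\<close>

definition weakly_regular_pair ::
  "('m, 'e::real_normed_vector) chart set \<Rightarrow> ('m, 'e) potential \<Rightarrow> ('m, 'e) dual_potential \<Rightarrow> bool" where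
  "weakly_regular_pair A \<Psi> \<Psi>s \<longleftrightarrow>
     (\<forall>z. strictly_convex_on (tangent_space A z) (\<Psi> z)) \<and> C1_on_cotangent_bundle A \<Psi>s"

definition degenerate_dissipation_potentials ::
  "('m, 'e::real_normed_vector) chart set \<Rightarrow> ('m, 'e) potential \<Rightarrow> ('m, 'e) dual_potential \<Rightarrow> bool" where
  "degenerate_dissipation_potentials A \<Psi> \<Psi>s \<longleftrightarrow>
     legendre_duals A \<Psi> \<Psi>s \<and> weakly_regular_pair A \<Psi> \<Psi>s \<and> (\<forall>z. \<Psi> z 0 = 0 \<and> \<Psi>s z 0 = 0)"

definition symmetric_potential ::
  "('m, 'e::real_normed_vector) chart set \<Rightarrow> ('m, 'e) potential \<Rightarrow> bool" where
  "symmetric_potential A \<Psi> \<longleftrightarrow> (\<forall>z. \<forall>v\<in>tangent_space A z. \<Psi> z v = \<Psi> z (- v))"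

definition symmetric_dual_potential ::
  "('m, 'e::real_normed_vector) chart set \<Rightarrow> ('m, 'e) dual_potential \<Rightarrow> bool" where
  "symmetric_dual_potential A \<Psi>s \<longleftrightarrow> (\<forall>z. \<forall>\<xi>\<in>cotangent_space A z. \<Psi>s z \<xi> = \<Psi>s z (- \<xi>))"

definition reversible ::
  "('m, 'e::real_normed_vector) chart set \<Rightarrow> ('m \<Rightarrow> ('m, 'e) covec \<Rightarrow> real) \<Rightarrow> ('m \<Rightarrow> real) \<Rightarrow> bool" where
  "reversible A H S \<longleftrightarrow>
     (\<forall>z. \<forall>\<xi>\<in>cotangent_space A z. H z \<xi> = H z (differential A S z - \<xi>))"

definition zero_cost_flow ::
  "('m, 'e::real_normed_vector) chart set \<Rightarrow> ('m, 'e) potential \<Rightarrow> ('m \<Rightarrow> ('m, 'e) tvec) \<Rightarrow> bool" where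
  "zero_cost_flow A Lag F \<longleftrightarrow> (\<forall>z. \<forall>v\<in>tangent_space A z. Lag z v = 0 \<longleftrightarrow> v = F z)"


section \<open>Poisson operators and GENERIC\<close>

type_synonym ('m, 'e) operator_family = "'m \<Rightarrow> ('m, 'e) covec \<Rightarrow> ('m, 'e) tvec"

definition operator_family ::
  "('m, 'e::real_normed_vector) chart set \<Rightarrow> ('m, 'e) operator_family \<Rightarrow> bool" where
  "operator_family A L \<longleftrightarrow> (\<forall>z. \<forall>\<xi>\<in>cotangent_space A z.
     L z \<xi> \<in> tangent_space A z \<and>
     (\<forall>\<eta>\<in>cotangent_space A z. L z (\<xi> + \<eta>) = L z \<xi> + L z \<eta>) \<and>
     (\<forall>a. L z (a *\<^sub>R \<xi>) = a *\<^sub>R L z \<xi>))"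

definition antisymmetric ::
  "('m, 'e::real_normed_vector) chart set \<Rightarrow> ('m, 'e) operator_family \<Rightarrow> bool" where
  "antisymmetric A L \<longleftrightarrow> (\<forall>z. \<forall>\<xi>\<in>cotangent_space A z. \<forall>\<eta>\<in>cotangent_space A z.
     pairing (L z \<xi>) \<eta> = - pairing (L z \<eta>) \<xi>)"

definition bracket ::
  "('m, 'e::real_normed_vector) chart set \<Rightarrow> ('m, 'e) operator_family \<Rightarrow>
   ('m \<Rightarrow> real) \<Rightarrow> ('m \<Rightarrow> real) \<Rightarrow> 'm \<Rightarrow> real" where
  "bracket A L F G z = pairing (L z (differential A G z)) (differential A F z)"

text \<open>The first conjunct makes the differentials in the iterated brackets meaningful; it holds
  automatically if \<open>L\<close> depends smoothly on the base point.\<close>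

definition jacobi_identity ::
  "('m, 'e::real_normed_vector) chart set \<Rightarrow> ('m, 'e) operator_family \<Rightarrow> bool" where
  "jacobi_identity A L \<longleftrightarrow>
     (\<forall>F G. smooth_fun A F \<and> smooth_fun A G \<longrightarrow> C_k A 1 (bracket A L F G)) \<and>
     (\<forall>F1 F2 F3. smooth_fun A F1 \<and> smooth_fun A F2 \<and> smooth_fun A F3 \<longrightarrow>
        (\<forall>z. bracket A L (bracket A L F1 F2) F3 z + bracket A L (bracket A L F3 F1) F2 z
             + bracket A L (bracket A L F2 F3) F1 z = 0))"

text \<open>\<open>D\<close> is the notion of a pair of dissipation potentials that is used: GENERIC in the strict sense
  is \<open>GENERIC A (dissipation_potentials A)\<close>.\<close>

definition GENERIC ::
  "('m, 'e::real_normed_vector) chart set \<Rightarrow>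
   (('m, 'e) potential \<Rightarrow> ('m, 'e) dual_potential \<Rightarrow> bool) \<Rightarrow>
   ('m \<Rightarrow> real) \<Rightarrow> ('m \<Rightarrow> real) \<Rightarrow> ('m, 'e) potential \<Rightarrow> ('m, 'e) dual_potential \<Rightarrow>
   ('m, 'e) operator_family \<Rightarrow> ('m \<Rightarrow> ('m, 'e) tvec) \<Rightarrow> bool" where
  "GENERIC A D S E \<Psi> \<Psi>s L F \<longleftrightarrow>
     (D \<Psi> \<Psi>s \<and> symmetric_potential A \<Psi> \<and> symmetric_dual_potential A \<Psi>s) \<and>
     (operator_family A L \<and> antisymmetric A L \<and> jacobi_identity A L) \<and>
     (\<forall>z. L z (differential A S z) = 0) \<and>
     (\<forall>z. \<forall>\<xi>\<in>cotangent_space A z. \<forall>\<alpha>. \<Psi>s z (\<xi> + \<alpha> *\<^sub>R differential A E z) = \<Psi>s z \<xi>) \<and>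
     (\<forall>z. \<Psi> z (F z - L z (differential A E z)) + \<Psi>s z (- ((1/2) *\<^sub>R differential A S z))
          + ereal (1/2 * pairing (F z) (differential A S z)) = 0)"


section \<open>Well-definedness of the encodings\<close>

lemma charts_at_nonempty:
  assumes "smooth_manifold A" shows "\<exists>c. c \<in> charts_at A z"
  using assms unfolding smooth_manifold_def charts_at_def by blast

lemma chart_inv_map:
  assumes "smooth_manifold A" "c \<in> charts_at A z"
  shows "chart_inv c (chart_map c z) = z"
  using assms unfolding smooth_manifold_def charts_at_def is_chart_def homeomorphism_def by blast

lemma transition_differentiable:
  assumes "smooth_manifold A" "c \<in> charts_at A z" "d \<in> charts_at A z"
  shows "transition c d differentiable (at (chart_map c z))"
proof -
  have "C_k_on 1 (chart_map c ` (chart_dom c \<inter> chart_dom d)) (transition c d)"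
    using assms unfolding smooth_manifold_def charts_at_def smooth_on_def by blast
  then show ?thesis using assms(2,3) by (auto simp: charts_at_def)
qed

lemma tangent_space_zero: "v \<in> tangent_space A z \<Longrightarrow> c \<notin> charts_at A z \<Longrightarrow> v c = 0"
  unfolding tangent_space_def by blast

lemma tangent_space_transition:
  assumes "v \<in> tangent_space A z" "c \<in> charts_at A z" "d \<in> charts_at A z"
  shows "v d = frechet_derivative (transition c d) (at (chart_map c z)) (v c)"
  using assms unfolding tangent_space_def by blast

lemma tangent_spaceI:
  assumes "\<And>c. c \<notin> charts_at A z \<Longrightarrow> v c = 0"
    and "\<And>c d. c \<in> charts_at A z \<Longrightarrow> d \<in> charts_at A z \<Longrightarrow>
      v d = frechet_derivative (transition c d) (at (chart_map c z)) (v c)"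
  shows "v \<in> tangent_space A z"
  using assms unfolding tangent_space_def by blast

lemma subspace_tangent_space:
  assumes "smooth_manifold A" shows "subspace (tangent_space A z)"
proof (rule subspaceI)
  have lin: "linear (frechet_derivative (transition c d) (at (chart_map c z)))"
    if "c \<in> charts_at A z" "d \<in> charts_at A z" for c d
    by (rule linear_frechet_derivative[OF transition_differentiable[OF assms that]])
  show "0 \<in> tangent_space A z"
  proof (rule tangent_spaceI)
    fix c d assume "c \<in> charts_at A z" "d \<in> charts_at A z"
    from linear_0[OF lin[OF this]]
    show "0 d = frechet_derivative (transition c d) (at (chart_map c z)) (0 c)" by simp
  qed simp
  show "u + v \<in> tangent_space A z" if u: "u \<in> tangent_space A z" and v: "v \<in> tangent_space A z" for u v
  proof (rule tangent_spaceI)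
    fix c d assume cd: "c \<in> charts_at A z" "d \<in> charts_at A z"
    show "(u + v) d = frechet_derivative (transition c d) (at (chart_map c z)) ((u + v) c)"
      unfolding plus_fun_apply linear_add[OF lin[OF cd]]
        tangent_space_transition[OF u cd] tangent_space_transition[OF v cd] ..
  qed (simp add: tangent_space_zero[OF u] tangent_space_zero[OF v])
  show "a *\<^sub>R v \<in> tangent_space A z" if v: "v \<in> tangent_space A z" for a v
  proof (rule tangent_spaceI)
    fix c d assume cd: "c \<in> charts_at A z" "d \<in> charts_at A z"
    show "(a *\<^sub>R v) d = frechet_derivative (transition c d) (at (chart_map c z)) ((a *\<^sub>R v) c)"
      unfolding scaleR_fun_apply linear_scale[OF lin[OF cd]] tangent_space_transition[OF v cd] ..
  qed (simp add: tangent_space_zero[OF v])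
qed

lemma subspace_cotangent_space: "smooth_manifold A \<Longrightarrow> subspace (cotangent_space A z)"
  unfolding subspace_def cotangent_space_def by (auto simp: algebra_simps)

lemma C_1_differentiable:
  assumes "smooth_manifold A" "C_k A 1 F" "c \<in> charts_at A z"
  shows "(F \<circ> chart_inv c) differentiable (at (chart_map c z))"
  using assms unfolding C_k_def charts_at_def chart_image_def by auto

lemma differential_in_chart:
  assumes M: "smooth_manifold A" and F: "C_k A 1 F"
    and d: "d \<in> charts_at A z" and v: "v \<in> tangent_space A z"
  shows "differential A F z v = frechet_derivative (F \<circ> chart_inv d) (at (chart_map d z)) (v d)"
proof -
  define c where "c = (SOME c. c \<in> charts_at A z)"
  have c: "c \<in> charts_at A z"
    unfolding c_def using charts_at_nonempty[OF M] by (rule someI_ex)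
  let ?x = "chart_map c z" and ?y = "chart_map d z"
  let ?U = "chart_dom c \<inter> chart_dom d"
  have hc: "homeomorphism (chart_dom c) (chart_image c) (chart_map c) (chart_inv c)"
    and oc: "open (chart_image c)" and od: "open (chart_dom d)"
    using M c d unfolding smooth_manifold_def charts_at_def is_chart_def by auto
  have hd: "homeomorphism (chart_dom d) (chart_image d) (chart_map d) (chart_inv d)"
    using M d unfolding smooth_manifold_def charts_at_def is_chart_def by auto
  have eq: "chart_map c ` ?U = chart_image c \<inter> chart_inv c -` chart_dom d"
  proof -
    have "chart_image c = chart_map c ` chart_dom c" by (simp add: chart_image_def)
    moreover have "chart_inv c (chart_map c w) = w" if "w \<in> chart_dom c" for w
      using hc that by (auto simp: homeomorphism_def)
    ultimately show ?thesis by auto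
  qed
  have op: "open (chart_map c ` ?U)"
    unfolding eq using hc oc od
    by (intro continuous_open_preimage) (auto simp: homeomorphism_def)
  have "(transition c d has_derivative frechet_derivative (transition c d) (at ?x)) (at ?x)"
    using transition_differentiable[OF M c d] by (simp add: frechet_derivative_works[symmetric])
  moreover have ty: "transition c d ?x = ?y" using chart_inv_map[OF M c] by simp
  moreover have "((F \<circ> chart_inv d) has_derivative
      frechet_derivative (F \<circ> chart_inv d) (at ?y)) (at ?y)"
    using C_1_differentiable[OF M F d] by (simp add: frechet_derivative_works[symmetric])
  ultimately have "((F \<circ> chart_inv d) \<circ> transition c d has_derivative
      frechet_derivative (F \<circ> chart_inv d) (at ?y) \<circ> frechet_derivative (transition c d) (at ?x)) (at ?x)"
    by (intro diff_chain_at) simp_all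
  moreover have "((F \<circ> chart_inv d) \<circ> transition c d) x = (F \<circ> chart_inv c) x"
    if "x \<in> chart_map c ` ?U" for x
  proof -
    from that obtain w where w: "w \<in> chart_dom c" "w \<in> chart_dom d" "x = chart_map c w" by auto
    then have "chart_inv c x = w" "chart_inv d (chart_map d w) = w"
      using hc hd by (auto simp: homeomorphism_def)
    then show ?thesis by simp
  qed
  moreover have "?x \<in> chart_map c ` ?U" using c d by (auto simp: charts_at_def)
  ultimately have "((F \<circ> chart_inv c) has_derivative
      frechet_derivative (F \<circ> chart_inv d) (at ?y) \<circ> frechet_derivative (transition c d) (at ?x)) (at ?x)"
    using op by (metis (no_types, lifting) has_derivative_transform_within_open)
  then have "frechet_derivative (F \<circ> chart_inv c) (at ?x) =
      frechet_derivative (F \<circ> chart_inv d) (at ?y) \<circ> frechet_derivative (transition c d) (at ?x)"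
    by (simp add: frechet_derivative_at[symmetric])
  moreover have "v d = frechet_derivative (transition c d) (at ?x) (v c)"
    by (rule tangent_space_transition[OF v c d])
  ultimately show ?thesis
    using v unfolding differential_def c_def[symmetric] Let_def by simp
qed

lemma differential_in_cotangent_space:
  assumes M: "smooth_manifold A" and F: "C_k A 1 F"
  shows "differential A F z \<in> cotangent_space A z"
proof -
  obtain c where c: "c \<in> charts_at A z" using charts_at_nonempty[OF M] by blast
  have lin: "linear (frechet_derivative (F \<circ> chart_inv c) (at (chart_map c z)))"
    by (rule linear_frechet_derivative[OF C_1_differentiable[OF M F c]])
  have S: "subspace (tangent_space A z)" by (rule subspace_tangent_space[OF M])
  have "differential A F z v = 0" if "v \<notin> tangent_space A z" for v
    using that by (simp add: differential_def Let_def)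
  moreover note differential_in_chart[OF M F c]
  ultimately show ?thesis
    unfolding cotangent_space_def
    using lin S by (auto simp: linear_add linear_scale subspace_add subspace_scale)
qed

lemma dissipation_potentials_not_invariant:
  assumes M: "smooth_manifold A" and D: "dissipation_potentials A \<Psi> \<Psi>s"
    and \<eta>: "\<eta> \<in> cotangent_space A z"
    and inv: "\<And>\<xi> \<alpha>. \<xi> \<in> cotangent_space A z \<Longrightarrow> \<Psi>s z (\<xi> + \<alpha> *\<^sub>R \<eta>) = \<Psi>s z \<xi>"
  shows "\<eta> = 0"
proof (rule ccontr)
  assume "\<eta> \<noteq> 0"
  have 0: "0 \<in> cotangent_space A z"
    using subspace_cotangent_space[OF M] by (rule subspace_0)
  have z: "\<Psi>s z 0 = 0" "\<Psi>s z \<eta> = 0" "\<Psi>s z ((1/2) *\<^sub>R \<eta>) = 0"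
    using D inv[OF 0, of 1] inv[OF 0, of "1/2"] by (auto simp: dissipation_potentials_def)
  have "strictly_convex_on (cotangent_space A z) (\<Psi>s z)"
    using D by (auto simp: dissipation_potentials_def regular_pair_def)
  from this[unfolded strictly_convex_on_def, rule_format, OF 0 \<eta>, of "1/2"] \<open>\<eta> \<noteq> 0\<close> z
  show False by auto
qed

end

theory Submission
  imports Defs
begin

text \<open>Substituting \<open>\<xi> = \<eta> + \<sigma>\<close> with \<open>\<sigma> = dS/2\<close> in the supremum that defines the Lagrangian
  turns it into \<open>\<Psi>(v - W) + \<Psi>*(-\<sigma>) + \<langle>v - W, \<sigma>\<rangle>\<close>, and \<open>\<langle>W, dS\<rangle> = 0\<close>, so that condition (iv) of
  GENERIC says exactly that the Lagrangian vanishes at \<open>F\<close>.  By Fenchel's inequality a zero is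
  a minimum, and strict convexity of \<open>\<Psi>\<close> makes it unique.  Since \<open>\<Psi>\<close> is finite at \<open>F - W\<close> and \<open>\<Psi>*\<close> vanishes on
  the line spanned by \<open>dE\<close>, Fenchel's inequality also forces \<open>\<langle>F - W, dE\<rangle> = 0\<close>.\<close>

section \<open>Linearity of covectors on the tangent space\<close>

lemma cotangent_add:
  "\<xi> \<in> cotangent_space A z \<Longrightarrow> u \<in> tangent_space A z \<Longrightarrow> v \<in> tangent_space A z \<Longrightarrow>
    \<xi> (u + v) = \<xi> u + \<xi> v"
  by (simp add: cotangent_space_def)

lemma cotangent_scale:
  "\<xi> \<in> cotangent_space A z \<Longrightarrow> v \<in> tangent_space A z \<Longrightarrow> \<xi> (a *\<^sub>R v) = a * \<xi> v"
  by (simp add: cotangent_space_def)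

lemma cotangent_minus:
  "\<xi> \<in> cotangent_space A z \<Longrightarrow> v \<in> tangent_space A z \<Longrightarrow> \<xi> (- v) = - \<xi> v"
  using cotangent_scale[of \<xi> A z v "-1"] by simp

lemma cotangent_diff:
  assumes "smooth_manifold A"
    and "\<xi> \<in> cotangent_space A z" "u \<in> tangent_space A z" "v \<in> tangent_space A z"
  shows "\<xi> (u - v) = \<xi> u - \<xi> v"
  using cotangent_add[OF assms(2,3), of "- v"] cotangent_minus[OF assms(2,4)] assms
    subspace_neg[OF subspace_tangent_space] by fastforce

section \<open>Fenchel's inequality, its equality case, and the shifted Lagrangian\<close>

lemma legendre_duals_nonneg:
  assumes "legendre_duals A \<Psi> \<Psi>s"
  shows "v \<in> tangent_space A z \<Longrightarrow> 0 \<le> \<Psi> z v" and "\<xi> \<in> cotangent_space A z \<Longrightarrow> 0 \<le> \<Psi>s z \<xi>"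
  using assms unfolding legendre_duals_def by blast+

lemma legendre_duals_primal:
  assumes "legendre_duals A \<Psi> \<Psi>s" "v \<in> tangent_space A z"
  shows "\<Psi> z v = (SUP \<xi>\<in>cotangent_space A z. ereal (pairing v \<xi>) - \<Psi>s z \<xi>)"
  using assms unfolding legendre_duals_def by blast

lemma fenchel_inequality:
  assumes "legendre_duals A \<Psi> \<Psi>s" "v \<in> tangent_space A z" "\<xi> \<in> cotangent_space A z"
  shows "ereal (pairing v \<xi>) - \<Psi>s z \<xi> \<le> \<Psi> z v"
  unfolding legendre_duals_primal[OF assms(1,2)] by (rule SUP_upper[OF assms(3)])

text \<open>At the zero vector the pairing drops out, and since \<open>\<Psi>s\<close> is
  nonnegative every term of the supremum is at most 0. The normalisation of \<open>\<Psi>\<close> is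
  thus inherited from that of \<open>\<Psi>s\<close>.\<close>

lemma legendre_duals_primal_zero:
  assumes M: "smooth_manifold A" and D: "legendre_duals A \<Psi> \<Psi>s" and 0: "\<Psi>s z 0 = 0"
  shows "\<Psi> z 0 = 0"
proof (rule antisym)
  have T: "0 \<in> tangent_space A z"
    by (rule subspace_0[OF subspace_tangent_space[OF M]])
  have "ereal (pairing 0 \<xi>) - \<Psi>s z \<xi> \<le> 0" if \<xi>: "\<xi> \<in> cotangent_space A z" for \<xi>
  proof -
    have "pairing 0 \<xi> = 0"
      using cotangent_scale[OF \<xi> T, of 0] by simp
    then show ?thesis
      using legendre_duals_nonneg(2)[OF D \<xi>] by (cases "\<Psi>s z \<xi>") auto
  qed
  then show "\<Psi> z 0 \<le> 0"
    unfolding legendre_duals_primal[OF D T] by (rule SUP_least)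
  show "0 \<le> \<Psi> z 0"
    by (rule legendre_duals_nonneg(1)[OF D T])
qed

text \<open>Negation permutes the cotangent space, so the supremum for \<open>\<Psi>\<close> can be
  reindexed by it, which moves the sign from the covector to the vector.\<close>

lemma symmetric_dual_imp_symmetric_potential:
  assumes M: "smooth_manifold A" and D: "legendre_duals A \<Psi> \<Psi>s"
    and sym: "symmetric_dual_potential A \<Psi>s"
  shows "symmetric_potential A \<Psi>"
  unfolding symmetric_potential_def
proof (intro allI ballI)
  fix z v assume v: "v \<in> tangent_space A z"
  note neg = subspace_neg[OF subspace_cotangent_space[OF M]]
  have v': "- v \<in> tangent_space A z"
    by (rule subspace_neg[OF subspace_tangent_space[OF M] v])
  have im: "uminus ` cotangent_space A z = cotangent_space A z"
    using neg by (auto simp: image_iff) (metis minus_minus neg)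
  have "\<Psi> z v = (SUP \<xi>\<in>uminus ` cotangent_space A z. ereal (pairing v \<xi>) - \<Psi>s z \<xi>)"
    unfolding im by (rule legendre_duals_primal[OF D v])
  also have "\<dots> = (SUP \<xi>\<in>cotangent_space A z. ereal (pairing (- v) \<xi>) - \<Psi>s z \<xi>)"
    unfolding image_image
    using sym by (intro SUP_cong) (auto simp: symmetric_dual_potential_def cotangent_minus[OF _ v])
  also have "\<dots> = \<Psi> z (- v)"
    by (rule legendre_duals_primal[OF D v', symmetric])
  finally show "\<Psi> z v = \<Psi> z (- v)" .
qed

text \<open>Translation by \<open>\<sigma>\<close> permutes the cotangent space, and the terms free
  of the new variable leave the supremum. The real function \<open>p\<close> represents
  \<open>\<Psi>s z\<close>, so that no infinite values are subtracted.\<close>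

lemma lagrangian_of_shifted_dual:
  assumes M: "smooth_manifold A" and D: "legendre_duals A \<Psi> \<Psi>s"
    and v: "v \<in> tangent_space A z" and w: "w \<in> tangent_space A z" and \<sigma>: "\<sigma> \<in> cotangent_space A z"
    and p: "\<And>\<xi>. \<xi> \<in> cotangent_space A z \<Longrightarrow> \<Psi>s z \<xi> = ereal (p \<xi>)"
    and H: "\<And>\<xi>. \<xi> \<in> cotangent_space A z \<Longrightarrow> H z \<xi> = pairing w \<xi> + p (\<xi> - \<sigma>) - p (- \<sigma>)"
  shows "lagrangian A H z v = \<Psi> z (v - w) + \<Psi>s z (- \<sigma>) + ereal (pairing (v - w) \<sigma>)"
proof -
  note sub = subspace_cotangent_space[OF M, of z]
  have vw: "v - w \<in> tangent_space A z"
    by (rule subspace_diff[OF subspace_tangent_space[OF M] v w])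
  have p\<sigma>: "\<Psi>s z (- \<sigma>) = ereal (p (- \<sigma>))"
    by (rule p[OF subspace_neg[OF sub \<sigma>]])
  have im: "(\<lambda>\<eta>. \<eta> + \<sigma>) ` cotangent_space A z = cotangent_space A z"
  proof
    show "(\<lambda>\<eta>. \<eta> + \<sigma>) ` cotangent_space A z \<subseteq> cotangent_space A z"
      using subspace_add[OF sub _ \<sigma>] by auto
    show "cotangent_space A z \<subseteq> (\<lambda>\<eta>. \<eta> + \<sigma>) ` cotangent_space A z"
    proof
      fix \<xi> assume "\<xi> \<in> cotangent_space A z"
      then show "\<xi> \<in> (\<lambda>\<eta>. \<eta> + \<sigma>) ` cotangent_space A z"
        using subspace_diff[OF sub _ \<sigma>] by (intro image_eqI[of _ _ "\<xi> - \<sigma>"]) simp_all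
    qed
  qed
  have "lagrangian A H z v
      = (SUP \<xi>\<in>(\<lambda>\<eta>. \<eta> + \<sigma>) ` cotangent_space A z. ereal (pairing v \<xi> - H z \<xi>))"
    unfolding lagrangian_def im ..
  also have "\<dots> = (SUP \<eta>\<in>cotangent_space A z. (ereal (pairing (v - w) \<eta>) - \<Psi>s z \<eta>)
      + ereal (p (- \<sigma>) + pairing (v - w) \<sigma>))"
    unfolding image_image
  proof (rule SUP_cong[OF refl])
    fix \<eta> assume \<eta>: "\<eta> \<in> cotangent_space A z"
    have "H z (\<eta> + \<sigma>) = pairing w (\<eta> + \<sigma>) + p \<eta> - p (- \<sigma>)"
      using H[OF subspace_add[OF sub \<eta> \<sigma>]] by simp
    then show "ereal (pairing v (\<eta> + \<sigma>) - H z (\<eta> + \<sigma>))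
        = (ereal (pairing (v - w) \<eta>) - \<Psi>s z \<eta>) + ereal (p (- \<sigma>) + pairing (v - w) \<sigma>)"
      by (simp add: p[OF \<eta>] cotangent_diff[OF M \<eta> v w] cotangent_diff[OF M \<sigma> v w])
  qed
  also have "\<dots> = \<Psi> z (v - w) + ereal (p (- \<sigma>) + pairing (v - w) \<sigma>)"
    \<comment> \<open>The rule that moves a constant out of the supremum asks for a nonempty index
      set; the zero covector witnesses it.\<close>
    unfolding legendre_duals_primal[OF D vw] using subspace_0[OF sub]
    by (intro SUP_ereal_add_left) auto
  finally show ?thesis
    by (simp add: p\<sigma> add.assoc)
qed

text \<open>At the midpoint of two distinct points of equality, strict convexity would put
  \<open>\<Psi> z\<close> strictly below the affine function that it meets at both ends, while
  Fenchel's inequality keeps it above that function everywhere.\<close>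

lemma strictly_convex_fenchel_equality_unique:
  assumes M: "smooth_manifold A" and D: "legendre_duals A \<Psi> \<Psi>s"
    and sc: "strictly_convex_on (tangent_space A z) (\<Psi> z)"
    and u: "u \<in> tangent_space A z" and v: "v \<in> tangent_space A z" and \<xi>: "\<xi> \<in> cotangent_space A z"
    and eq_u: "\<Psi> z u = ereal (pairing u \<xi> - c)" and eq_v: "\<Psi> z v = ereal (pairing v \<xi> - c)"
    and c: "\<Psi>s z \<xi> = ereal c"
  shows "u = v"
proof (rule ccontr)
  assume "u \<noteq> v"
  define m where "m = (1 - 1/2) *\<^sub>R u + (1/2::real) *\<^sub>R v"
  note sub = subspace_tangent_space[OF M, of z]
  have uv: "(1 - 1/2) *\<^sub>R u \<in> tangent_space A z" "(1/2::real) *\<^sub>R v \<in> tangent_space A z"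
    using u v sub by (auto intro: subspace_scale)
  have m: "m \<in> tangent_space A z"
    unfolding m_def by (rule subspace_add[OF sub uv])
  have "\<Psi> z m < ereal (1 - 1/2) * \<Psi> z u + ereal (1/2) * \<Psi> z v"
    unfolding m_def
    using u v \<open>u \<noteq> v\<close> eq_u eq_v by (intro sc[unfolded strictly_convex_on_def, rule_format]) simp_all
  also have "\<dots> = ereal (pairing m \<xi> - c)"
    unfolding m_def eq_u eq_v cotangent_add[OF \<xi> uv] cotangent_scale[OF \<xi> u] cotangent_scale[OF \<xi> v]
    by (simp add: field_simps)
  also have "\<dots> = ereal (pairing m \<xi>) - \<Psi>s z \<xi>"
    by (simp add: c)
  also have "\<dots> \<le> \<Psi> z m"
    by (rule fenchel_inequality[OF D m \<xi>])
  finally show False by simp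
qed

text \<open>On the line spanned by \<open>\<eta>\<close>, Fenchel's inequality bounds a linear
  function of the parameter by the finite number \<open>r\<close>, so its slope must vanish.\<close>

lemma finite_primal_annihilates_invariant_direction:
  assumes M: "smooth_manifold A" and D: "legendre_duals A \<Psi> \<Psi>s"
    and v: "v \<in> tangent_space A z" and \<eta>: "\<eta> \<in> cotangent_space A z"
    and inv: "\<And>\<alpha>. \<Psi>s z (\<alpha> *\<^sub>R \<eta>) = 0" and fin: "\<Psi> z v = ereal r"
  shows "pairing v \<eta> = 0"
proof (rule ccontr)
  assume n: "pairing v \<eta> \<noteq> 0"
  \<comment> \<open>Chosen so that the pairing of \<open>v\<close> with the multiple of
    \<open>\<eta>\<close> is \<open>r + 1\<close>, just beyond the bound.\<close>
  define \<alpha> where "\<alpha> = (r + 1) / pairing v \<eta>"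
  have "\<alpha> *\<^sub>R \<eta> \<in> cotangent_space A z"
    by (rule subspace_scale[OF subspace_cotangent_space[OF M] \<eta>])
  from fenchel_inequality[OF D v this] show False
    using n by (simp add: inv fin \<alpha>_def)
qed

text \<open>Regularity is a premise of each equivalence because (b) contains it and (a) does not
  mention it. Two versions are given because a strictly convex \<open>\<Psi>s\<close> can be
  invariant along dE only where dE vanishes; the degenerate notion also admits nonzero dE.\<close>

theorem corollary3p7:
  fixes A :: "('m::{t2_space, second_countable_topology}, 'e::real_normed_vector) chart set"
    and \<Psi> :: "('m, 'e) potential" and \<Psi>s :: "('m, 'e) dual_potential"
    and S E :: "'m \<Rightarrow> real"
    and F W :: "'m \<Rightarrow> ('m, 'e) tvec"
    and L :: "('m, 'e) operator_family"
    and H H1 H2 :: "'m \<Rightarrow> ('m, 'e) covec \<Rightarrow> real"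
  assumes manifold: "smooth_manifold A"
    and duals: "legendre_duals A \<Psi> \<Psi>s"
    and S: "C_k A 1 S" and E: "C_k A 1 E"
    and F: "vector_field A F"
    and L: "operator_family A L" "antisymmetric A L" "jacobi_identity A L"
    and W: "vector_field A W"
      "\<And>z. pairing (W z) (differential A S z) = 0"
      "\<And>z. W z = L z (differential A E z)"
    and H1: "\<And>z \<xi>. \<xi> \<in> cotangent_space A z \<Longrightarrow> H1 z \<xi> = pairing (W z) \<xi>"
    and \<Psi>s_H2: "\<And>z \<xi>. \<xi> \<in> cotangent_space A z \<Longrightarrow>
      \<Psi>s z \<xi> = ereal (H2 z (\<xi> + (1/2) *\<^sub>R differential A S z) - H2 z ((1/2) *\<^sub>R differential A S z))"
    and H2_\<Psi>s: "\<And>z \<xi>. \<xi> \<in> cotangent_space A z \<Longrightarrow>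
      ereal (H2 z \<xi>) = \<Psi>s z (\<xi> - (1/2) *\<^sub>R differential A S z) - \<Psi>s z (- ((1/2) *\<^sub>R differential A S z))"
    and H: "\<And>z \<xi>. \<xi> \<in> cotangent_space A z \<Longrightarrow> H z \<xi> = H1 z \<xi> + H2 z \<xi>"
  shows
    "let a = (reversible A H2 S \<and>
              (\<forall>z. L z (differential A S z) = 0) \<and>
              (\<forall>z. \<forall>\<xi>\<in>cotangent_space A z. \<forall>\<alpha> \<beta>.
                 H2 z (\<xi> + \<alpha> *\<^sub>R differential A E z) = H2 z (\<xi> + \<beta> *\<^sub>R differential A E z)) \<and>
              zero_cost_flow A (lagrangian A H) F);
         b = (symmetric_dual_potential A \<Psi>s \<and>
              GENERIC A (dissipation_potentials A) S E \<Psi> \<Psi>s L F);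
         b' = (symmetric_dual_potential A \<Psi>s \<and>
              GENERIC A (degenerate_dissipation_potentials A) S E \<Psi> \<Psi>s L F)
     in (regular_pair A \<Psi> \<Psi>s \<longrightarrow> (a \<longleftrightarrow> b)) \<and>
        (weakly_regular_pair A \<Psi> \<Psi>s \<longrightarrow> (a \<longleftrightarrow> b')) \<and>
        (a \<or> b \<or> b' \<longrightarrow>
           (\<forall>z. pairing (F z) (differential A S z) \<le> 0) \<and>
           (\<forall>z. pairing (F z) (differential A E z) = 0))"
proof -

  \<comment> \<open>Notation and membership in the fibres\<close>
  define \<sigma> where "\<sigma> z = (1/2::real) *\<^sub>R differential A S z" for z
  \<comment> \<open>The real representative of \<open>\<Psi>s\<close> on cotangent spaces:
    finiteness comes from \<open>H2\<close> being real-valued.\<close>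
  define p where "p z \<xi> = H2 z (\<xi> + \<sigma> z) - H2 z (\<sigma> z)" for z \<xi>
  define rev where "rev \<longleftrightarrow> reversible A H2 S"
  define h2inv where "h2inv \<longleftrightarrow> (\<forall>z. \<forall>\<xi>\<in>cotangent_space A z. \<forall>\<alpha> \<beta>.
    H2 z (\<xi> + \<alpha> *\<^sub>R differential A E z) = H2 z (\<xi> + \<beta> *\<^sub>R differential A E z))"
  define psinv where "psinv \<longleftrightarrow> (\<forall>z. \<forall>\<xi>\<in>cotangent_space A z. \<forall>\<alpha>.
    \<Psi>s z (\<xi> + \<alpha> *\<^sub>R differential A E z) = \<Psi>s z \<xi>)"
  define bal where "bal \<longleftrightarrow> (\<forall>z. \<Psi> z (F z - L z (differential A E z))
    + \<Psi>s z (- ((1/2) *\<^sub>R differential A S z)) + ereal (1/2 * pairing (F z) (differential A S z)) = 0)"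
  note subT = subspace_tangent_space[OF manifold]
  note subC = subspace_cotangent_space[OF manifold]
  have dS: "differential A S z \<in> cotangent_space A z" for z
    by (rule differential_in_cotangent_space[OF manifold S])
  have dE: "differential A E z \<in> cotangent_space A z" for z
    by (rule differential_in_cotangent_space[OF manifold E])
  have \<sigma>: "\<sigma> z \<in> cotangent_space A z" for z
    unfolding \<sigma>_def by (rule subspace_scale[OF subC dS])
  have \<sigma>2: "differential A S z = \<sigma> z + \<sigma> z" for z
    unfolding \<sigma>_def by (simp flip: scaleR_add_left)
  have FT: "F z \<in> tangent_space A z" and WT: "W z \<in> tangent_space A z" for z
    using F W(1) by (auto simp: vector_field_def)
  have FWT: "F z - W z \<in> tangent_space A z" for z
    by (rule subspace_diff[OF subT FT WT])
  have p: "\<Psi>s z \<xi> = ereal (p z \<xi>)" if "\<xi> \<in> cotangent_space A z" for z \<xi>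
    using \<Psi>s_H2[OF that] by (simp add: p_def \<sigma>_def)
  have \<Psi>s0: "\<Psi>s z 0 = 0" for z
    using p[OF subspace_0[OF subC]] by (simp add: p_def zero_ereal_def)
  have H2p: "H2 z \<xi> = p z (\<xi> - \<sigma> z) - p z (- \<sigma> z)" if "\<xi> \<in> cotangent_space A z" for z \<xi>
    using H2_\<Psi>s[OF that] p[OF subspace_diff[OF subC that \<sigma>]] p[OF subspace_neg[OF subC \<sigma>]]
    by (simp add: \<sigma>_def)

  \<comment> \<open>The Lagrangian and the balance condition (iv)\<close>
  have lag: "lagrangian A H z v = \<Psi> z (v - W z) + \<Psi>s z (- ((1/2) *\<^sub>R differential A S z))
      + ereal (1/2 * pairing v (differential A S z))" if v: "v \<in> tangent_space A z" for z v
  proof -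
    have "lagrangian A H z v = \<Psi> z (v - W z) + \<Psi>s z (- \<sigma> z) + ereal (pairing (v - W z) (\<sigma> z))"
      using H H1 H2p
      by (intro lagrangian_of_shifted_dual[OF manifold duals v WT \<sigma>, where p = "p z"]) (auto simp: p)
    \<comment> \<open>Orthogonality of \<open>W\<close> and dS removes \<open>W\<close> from the
      linear term, which leaves the one of (iv).\<close>
    moreover have "pairing (v - W z) (\<sigma> z) = 1/2 * pairing v (differential A S z)"
      using cotangent_diff[OF manifold dS v WT] by (simp add: \<sigma>_def W(2))
    ultimately show ?thesis
      by (simp only: \<sigma>_def)
  qed
  have bal_lag: "bal \<longleftrightarrow> (\<forall>z. lagrangian A H z (F z) = 0)"
    unfolding bal_def using lag[OF FT] by (simp add: W(3))

  \<comment> \<open>Reversibility versus symmetry, and invariance along dE\<close>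
  have rev_sym: "rev \<longleftrightarrow> symmetric_dual_potential A \<Psi>s"
  proof
    assume rev
    show "symmetric_dual_potential A \<Psi>s"
      unfolding symmetric_dual_potential_def
    proof (intro allI ballI)
      fix z \<xi> assume \<xi>: "\<xi> \<in> cotangent_space A z"
      \<comment> \<open>The reflection \<xi> \<mapsto> dS - \<xi> has centre
        \<open>\<sigma> z\<close>; in coordinates centred there it is negation.\<close>
      have "H2 z (\<xi> + \<sigma> z) = H2 z (differential A S z - (\<xi> + \<sigma> z))"
        using \<open>rev\<close> subspace_add[OF subC \<xi> \<sigma>] by (simp only: rev_def reversible_def)
      also have "differential A S z - (\<xi> + \<sigma> z) = - \<xi> + \<sigma> z"
        unfolding \<sigma>2 by simp
      finally show "\<Psi>s z \<xi> = \<Psi>s z (- \<xi>)"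
        unfolding p[OF \<xi>] p[OF subspace_neg[OF subC \<xi>]] p_def by (simp only:)
    qed
  next
    assume sym: "symmetric_dual_potential A \<Psi>s"
    have "H2 z \<xi> = H2 z (differential A S z - \<xi>)" if \<xi>: "\<xi> \<in> cotangent_space A z" for z \<xi>
    proof -
      have d: "\<xi> - \<sigma> z \<in> cotangent_space A z"
        by (rule subspace_diff[OF subC \<xi> \<sigma>])
      then have "\<Psi>s z (\<xi> - \<sigma> z) = \<Psi>s z (- (\<xi> - \<sigma> z))"
        using sym by (simp only: symmetric_dual_potential_def)
      then have "p z (\<xi> - \<sigma> z) = p z (- (\<xi> - \<sigma> z))"
        unfolding p[OF d] p[OF subspace_neg[OF subC d]] by simp
      also have "- (\<xi> - \<sigma> z) = differential A S z - \<xi> - \<sigma> z"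
        unfolding \<sigma>2 by simp
      finally show ?thesis
        unfolding H2p[OF \<xi>] H2p[OF subspace_diff[OF subC dS \<xi>]] by (simp only:)
    qed
    then show rev
      by (simp add: rev_def reversible_def)
  qed
  have inv_iff: "h2inv \<longleftrightarrow> psinv"
  proof
    assume h: h2inv
    have "\<Psi>s z (\<xi> + \<alpha> *\<^sub>R differential A E z) = \<Psi>s z \<xi>"
      if \<xi>: "\<xi> \<in> cotangent_space A z" for z \<xi> \<alpha>
    proof -
      \<comment> \<open>Constancy in the parameter is compared at \<open>\<alpha>\<close> and 0; the
        shift by \<open>\<sigma> z\<close> commutes with translations along dE.\<close>
      have "H2 z (\<xi> + \<sigma> z + \<alpha> *\<^sub>R differential A E z) = H2 z (\<xi> + \<sigma> z + 0 *\<^sub>R differential A E z)"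
        using h subspace_add[OF subC \<xi> \<sigma>] unfolding h2inv_def by blast
      then show ?thesis
        unfolding p[OF \<xi>] p[OF subspace_add[OF subC \<xi> subspace_scale[OF subC dE]]] p_def
        by (simp add: ac_simps)
    qed
    then show psinv by (simp add: psinv_def)
  next
    assume ps: psinv
    have "H2 z (\<xi> + \<alpha> *\<^sub>R differential A E z) = H2 z \<xi>"
      if \<xi>: "\<xi> \<in> cotangent_space A z" for z \<xi> \<alpha>
    proof -
      have d: "\<xi> - \<sigma> z \<in> cotangent_space A z"
        by (rule subspace_diff[OF subC \<xi> \<sigma>])
      have a: "\<alpha> *\<^sub>R differential A E z \<in> cotangent_space A z"
        by (rule subspace_scale[OF subC dE])
      have "\<Psi>s z (\<xi> - \<sigma> z + \<alpha> *\<^sub>R differential A E z) = \<Psi>s z (\<xi> - \<sigma> z)"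
        using ps d unfolding psinv_def by blast
      then have "p z (\<xi> - \<sigma> z + \<alpha> *\<^sub>R differential A E z) = p z (\<xi> - \<sigma> z)"
        unfolding p[OF d] p[OF subspace_add[OF subC d a]] by simp
      moreover have "\<xi> - \<sigma> z + \<alpha> *\<^sub>R differential A E z = \<xi> + \<alpha> *\<^sub>R differential A E z - \<sigma> z"
        by simp
      ultimately show ?thesis
        unfolding H2p[OF \<xi>] H2p[OF subspace_add[OF subC \<xi> a]] by simp
    qed
    then show h2inv by (simp add: h2inv_def)
  qed

  \<comment> \<open>Zero-cost flow versus balance\<close>
  have zcf_bal: "bal" if "zero_cost_flow A (lagrangian A H) F"
    using that FT by (simp add: bal_lag zero_cost_flow_def)
  \<comment> \<open>Strict convexity is a local premise so that either regularity notion can supply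
    it.\<close>
  have bal_zcf: "zero_cost_flow A (lagrangian A H) F"
    if bal and sc: "\<And>z. strictly_convex_on (tangent_space A z) (\<Psi> z)"
    unfolding zero_cost_flow_def
  proof (intro allI ballI iffI)
    fix z v assume v: "v \<in> tangent_space A z"
    show "lagrangian A H z v = 0" if "v = F z"
      using \<open>bal\<close> that by (simp add: bal_lag)
    assume lv: "lagrangian A H z v = 0"
    have n\<sigma>: "- \<sigma> z \<in> cotangent_space A z"
      by (rule subspace_neg[OF subC \<sigma>])
    \<comment> \<open>A zero of the Lagrangian is a case of equality in Fenchel's inequality at the
      covector \<open>- \<sigma> z\<close>. Applied to both \<open>v\<close> and \<open>F z\<close>,
      this feeds the uniqueness lemma.\<close>
    have eq: "\<Psi> z (u - W z) = ereal (pairing (u - W z) (- \<sigma> z) - p z (- \<sigma> z))"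
      if u: "u \<in> tangent_space A z" and l: "lagrangian A H z u = 0" for u
    proof -
      have "\<Psi> z (u - W z) + ereal (p z (- \<sigma> z)) + ereal (1/2 * pairing u (differential A S z)) = 0"
        using lag[OF u] p[OF n\<sigma>] l by (simp add: \<sigma>_def)
      moreover have "pairing (u - W z) (- \<sigma> z) = - (1/2 * pairing u (differential A S z))"
        using cotangent_diff[OF manifold dS u WT] by (simp add: \<sigma>_def W(2))
      ultimately show ?thesis
        by (cases "\<Psi> z (u - W z)") (auto simp: zero_ereal_def)
    qed
    have lF: "lagrangian A H z (F z) = 0"
      using \<open>bal\<close> by (simp add: bal_lag)
    have "v - W z = F z - W z"
      by (rule strictly_convex_fenchel_equality_unique[where \<xi> = "- \<sigma> z",
            OF manifold duals sc subspace_diff[OF subT v WT] FWT n\<sigma>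
              eq[OF v lv] eq[OF FT lF] p[OF n\<sigma>]])
    then show "v = F z" by simp
  qed

  \<comment> \<open>Lyapunov property and conservation of energy\<close>
  have flow: "pairing (F z) (differential A S z) \<le> 0 \<and> pairing (F z) (differential A E z) = 0"
    if b: bal and ps: psinv for z
  proof -
    have bz: "\<Psi> z (F z - W z) + \<Psi>s z (- \<sigma> z)
        + ereal (1/2 * pairing (F z) (differential A S z)) = 0"
      using b by (simp add: bal_def W(3) \<sigma>_def)
    have ps\<sigma>: "\<Psi>s z (- \<sigma> z) = ereal (p z (- \<sigma> z))"
      by (rule p[OF subspace_neg[OF subC \<sigma>]])
    have "0 \<le> p z (- \<sigma> z)"
      using legendre_duals_nonneg(2)[OF duals subspace_neg[OF subC \<sigma>], of z] ps\<sigma> by simp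
    \<comment> \<open>The other two summands of the balance are real and the total is 0, which
      forces this one to be finite. As both potentials are nonnegative, the remaining summand cannot
      be positive.\<close>
    moreover obtain r where r: "\<Psi> z (F z - W z) = ereal r"
      using bz ps\<sigma> by (cases "\<Psi> z (F z - W z)") auto
    moreover have "0 \<le> r"
      using legendre_duals_nonneg(1)[OF duals FWT, of z] r by simp
    ultimately have "pairing (F z) (differential A S z) \<le> 0"
      using bz ps\<sigma> by (simp add: zero_ereal_def)
    moreover have "\<Psi>s z (\<alpha> *\<^sub>R differential A E z) = 0" for \<alpha>
      using ps subspace_0[OF subC, of z] \<Psi>s0[of z] unfolding psinv_def
      by (metis add_0)
    from finite_primal_annihilates_invariant_direction[OF manifold duals FWT dE this r]
    have "pairing (F z - W z) (differential A E z) = 0" .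
    \<comment> \<open>Anti-symmetry with dE in both slots: the number equals its own negative, so
      \<open>W\<close> preserves \<open>E\<close> and only \<open>F z - W z\<close> had to be
      treated.\<close>
    moreover have "pairing (W z) (differential A E z) = - pairing (W z) (differential A E z)"
      using L(2) dE[of z] unfolding antisymmetric_def W(3) by blast
    ultimately show ?thesis
      using cotangent_diff[OF manifold dE FT WT] by simp
  qed

  \<comment> \<open>Assembling the equivalences\<close>
  have generic: "GENERIC A D S E \<Psi> \<Psi>s L F \<longleftrightarrow> D \<Psi> \<Psi>s \<and> symmetric_dual_potential A \<Psi>s \<and>
      (\<forall>z. L z (differential A S z) = 0) \<and> psinv \<and> bal" for D
    unfolding GENERIC_def psinv_def[symmetric] bal_def[symmetric]
    using L symmetric_dual_imp_symmetric_potential[OF manifold duals] by blast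
  \<comment> \<open>Duality is assumed and both normalisations follow from the relation to
    \<open>H2\<close>, so each notion reduces to its regularity part.\<close>
  have D: "dissipation_potentials A \<Psi> \<Psi>s \<longleftrightarrow> regular_pair A \<Psi> \<Psi>s"
    "degenerate_dissipation_potentials A \<Psi> \<Psi>s \<longleftrightarrow> weakly_regular_pair A \<Psi> \<Psi>s"
    using duals \<Psi>s0 legendre_duals_primal_zero[OF manifold duals \<Psi>s0]
    by (auto simp: dissipation_potentials_def degenerate_dissipation_potentials_def)
  have sc: "\<And>z. strictly_convex_on (tangent_space A z) (\<Psi> z)"
    if "regular_pair A \<Psi> \<Psi>s \<or> weakly_regular_pair A \<Psi> \<Psi>s"
    using that by (auto simp: regular_pair_def weakly_regular_pair_def)
  show ?thesis
    \<comment> \<open>After rewriting, the sides differ only in zero-cost flow against balance, plus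
      the regularity that yields \<open>sc\<close>. The final claim needs just balance and
      invariance, and (a) gives balance without convexity.\<close>
    unfolding Let_def generic D rev_def[symmetric] h2inv_def[symmetric] rev_sym inv_iff
    using zcf_bal bal_zcf[OF _ sc] flow by meson
qed

end
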